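(* For balanced affine two-colour urn schemes with multiple drawings, the second moment of the number $W_n$ of white balls after $n$ draws is, for model $\mathcal M$, $$\mathbb E[W_n^2]=\frac{\binom{n-1+\lambda_1}{n}\binom{n-1+\lambda_2}{n}}{\binom{n-1+\frac{T_0}\sigma}{n}\binom{n-1+\frac{T_0-1}\sigma}{n}}\bigg(W_0^2+\sum_{j=1}^n\frac{(\beta_j\mathbb E[W_{j-1}]+a_m^2)\binom{j-1+\frac{T_0}\sigma}{j}\binom{j-1+\frac{T_0-1}\sigma}{j}}{\binom{j-1+\lambda_1}{j}\binom{j-1+\lambda_2}{j}}\bigg),$$ with $\lambda_{1,2}=\frac{m(a_{m-1}-a_m)+T_0-\frac12\pm\frac12\sqrt{1+4m(a_{m-1}-a_m)(a_{m-1}-a_m+1)}}{\sigma}$ and $$\beta_n=(a_{m-1}-a_m)^2\Big(\frac m{T_{n-1}}-\frac{m(m-1)}{T_{n-1}(T_{n-1}-1)}\Big)+\frac{2ma_m(a_{m-1}-a_m)}{T_{n-1}}+2a_m.$$ For model $\mathcal R$, the second moment of $W_n$ is $$\mathbb E[W_n^2]=\frac{\binom{n-1+\mu_1}{n}\binom{n-1+\mu_2}{n}}{\binom{n-1+\frac{T_0}\sigma}{n}^2}\bigg(W_0^2+\sum_{j=1}^n\frac{(\beta_j\mathbb E[W_{j-1}]+a_m^2)\binom{j-1+\frac{T_0}\sigma}{j}^2}{\binom{j-1+\mu_1}{j}\binom{j-1+\mu_2}{j}}\bigg),$$ with $\mu_{1,2}=\frac{m(a_{m-1}-a_m)+T_0\pm(a_{m-1}-a_m)\sqrt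 m}{\sigma}$ and $$\beta_n=\frac{(a_{m-1}-a_m)^2m}{T_{n-1}}+\frac{2ma_m(a_{m-1}-a_m)}{T_{n-1}}+2a_m.$$
   Context: Urn setting. Let $m\ge1$ be an integer (sample size), and let $a_k,b_k$ ($0\le k\le m$) be integers with $a_k+b_k=\sigma$ for all $k$ (the urn is balanced), where $\sigma\ge1$. The urn starts with $W_0,B_0\in\mathbb N_0$ white and black balls, $W_0+B_0\ge m$. At step $n\ge1$ a sample of $m$ balls is drawn from the urn, which contains $W_{n-1}$ white and $B_{n-1}$ black balls; the sample is returned, and if it contained $k$ white and $m-k$ black balls, then $a_{m-k}$ white and $b_{m-k}$ black balls are added (negative numbers mean removal). The total number of balls after $n$ draws is $T_n=W_n+B_n=T_0+\sigma n$. The urn is assumed tenable, i.e. the process of drawing and replacing balls can be continued ad infinitum. $\mathbb F_n$ is the $\sigma$-field generated by the first $n$ draws. Sampling models. Given $\mathbb F_{n-1}$, the probability that the $n$-th sample contains exactly $k$ white balls ($0\le k\le m$) is $\binom{W_{n-1}}{k}\binom{T_{n-1}-W_{n-1}}{m-k}\big/\binom{T_{n-1}}{m}$ in model $\mathcal M$ (without replacement) and $\binom mk W_{n-1}^k(T_{n-1}-W_{n-1})^{m-k}/T_{n-1}^m$ in model $\mathcal R$ (with replacement). Affine urn: $a_k=(m-k)a_{m-1}-(m-k-1)a_m$ for $0\le k\le m$. It is assumed throughout that $T_0+m(a_{m-1}-a_m)>0$. The expectation is, for both models, $\mathbb E[W_n]=\frac{a_m}{g_n}\sum_{j=1}^n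 g_j+\frac{W_0}{g_n}$ with $g_n=\prod_{j=0}^{n-1}\frac{T_j}{T_j+m(a_{m-1}-a_m)}$. Generalized binomial coefficients: $\binom{x}{n}=x(x-1)\cdots(x-n+1)/n!$.
   Formalization: The formulas are proved whenever their denominators are nonzero: for 1≤j≤n the binomials in λ_1, λ_2 (model M) or μ_1, μ_2 (model R) do not vanish, and T_{j-1}≠1 in model M; otherwise the displayed formula is undefined. *)

theory Defs
  imports "HOL-Probability.Probability"
begin

text \<open>
  Samples are recorded by their number \<open>k \<le> m\<close> of white balls. The two functions below give the
  probability of \<open>k\<close> when the urn contains \<open>W\<close> white and \<open>B\<close> black balls. The counts are integers
  because balls may be removed; for \<open>W, B \<ge> 0\<close> the generalized binomial coefficients are the
  ordinary ones.
\<close>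

definition without_replacement :: "nat \<Rightarrow> int \<Rightarrow> int \<Rightarrow> nat \<Rightarrow> real" where
  "without_replacement m W B k =
     (real_of_int W gchoose k) * (real_of_int B gchoose (m - k)) / (real_of_int (W + B) gchoose m)"

definition with_replacement :: "nat \<Rightarrow> int \<Rightarrow> int \<Rightarrow> nat \<Rightarrow> real" where
  "with_replacement m W B k =
     real (m choose k) * real_of_int W ^ k * real_of_int B ^ (m - k) / real_of_int (W + B) ^ m"

locale balanced_urn =
  fixes m :: nat and a b :: "nat \<Rightarrow> int" and \<sigma> :: int and W0 B0 :: nat
  assumes sample_size: "1 \<le> m"
    and balance_pos: "1 \<le> \<sigma>"
    and balanced: "\<And>k. k \<le> m \<Longrightarrow> a k + b k = \<sigma>"
    and initial_size: "m \<le> W0 + B0"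

locale balanced_affine_urn = balanced_urn +
  assumes affine: "\<And>k. k \<le> m \<Longrightarrow>
      a k = (int m - int k) * a (m - 1) - (int m - int k - 1) * a m"
    and initial_pos: "int (W0 + B0) + int m * (a (m - 1) - a m) > 0"

text \<open>
  Urn contents that occur with positive probability when samples are drawn according to \<open>p\<close>.
  The sample is returned before balls are added or removed, and by balance the total never
  decreases, so the process can be continued forever exactly if no count becomes negative.
\<close>

inductive reachable ::
  "(nat \<Rightarrow> int \<Rightarrow> int \<Rightarrow> nat \<Rightarrow> real) \<Rightarrow> nat \<Rightarrow> (nat \<Rightarrow> int) \<Rightarrow> (nat \<Rightarrow> int) \<Rightarrow> nat \<Rightarrow> nat
     \<Rightarrow> int \<Rightarrow> int \<Rightarrow> bool"
  for p m a b W0 B0 where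
  initial: "reachable p m a b W0 B0 (int W0) (int B0)"
| draw: "reachable p m a b W0 B0 W B \<Longrightarrow> k \<le> m \<Longrightarrow> p m W B k > 0 \<Longrightarrow>
    reachable p m a b W0 B0 (W + a (m - k)) (B + b (m - k))"

definition tenable ::
  "(nat \<Rightarrow> int \<Rightarrow> int \<Rightarrow> nat \<Rightarrow> real) \<Rightarrow> nat \<Rightarrow> (nat \<Rightarrow> int) \<Rightarrow> (nat \<Rightarrow> int) \<Rightarrow> nat \<Rightarrow> nat \<Rightarrow> bool"
  where
  "tenable p m a b W0 B0 \<longleftrightarrow> (\<forall>W B. reachable p m a b W0 B0 W B \<longrightarrow> 0 \<le> W \<and> 0 \<le> B)"

text \<open>
  \<open>X i\<close> is the number of white balls in the \<open>i\<close>-th sample (\<open>i \<ge> 1\<close>). With \<open>(a, W0)\<close> this is the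
  number of white balls after \<open>n\<close> draws, with \<open>(b, B0)\<close> the number of black balls.
\<close>

definition balls :: "nat \<Rightarrow> (nat \<Rightarrow> int) \<Rightarrow> nat \<Rightarrow> (nat \<Rightarrow> 's \<Rightarrow> nat) \<Rightarrow> nat \<Rightarrow> 's \<Rightarrow> int" where
  "balls m a W0 X n \<omega> = int W0 + (\<Sum>i=1..n. a (m - X i \<omega>))"

definition draws_field :: "'s measure \<Rightarrow> (nat \<Rightarrow> 's \<Rightarrow> nat) \<Rightarrow> nat \<Rightarrow> 's measure" where
  "draws_field P X n = sigma (space P) {X i -` A \<inter> space P | i A. 1 \<le> i \<and> i \<le> n}"

locale urn_process = prob_space P
  for P :: "'s measure" +
  fixes p :: "nat \<Rightarrow> int \<Rightarrow> int \<Rightarrow> nat \<Rightarrow> real"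
    and m :: nat and a b :: "nat \<Rightarrow> int" and W0 B0 :: nat
    and X :: "nat \<Rightarrow> 's \<Rightarrow> nat"
  assumes tenable: "tenable p m a b W0 B0"
    and draw_measurable: "\<And>n. 1 \<le> n \<Longrightarrow> X n \<in> measurable P (count_space UNIV)"
    and draw_le: "\<And>n \<omega>. 1 \<le> n \<Longrightarrow> \<omega> \<in> space P \<Longrightarrow> X n \<omega> \<le> m"
    and draw_law: "\<And>n k. 1 \<le> n \<Longrightarrow> k \<le> m \<Longrightarrow>
      AE \<omega> in P. real_cond_exp P (draws_field P X (n - 1))
          (indicator {\<omega> \<in> space P. X n \<omega> = k}) \<omega>
        = p m (balls m a W0 X (n - 1) \<omega>) (balls m b B0 X (n - 1) \<omega>) k"

text \<open>
  In the closed forms, \<open>c\<close> stands for \<open>a (m - 1) - a m\<close>, \<open>am\<close> for \<open>a m\<close>, \<open>T\<close> for the total number of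
  balls before the draw, and \<open>T0, s\<close> for the initial total and the balance.
\<close>

definition urn_total :: "int \<Rightarrow> nat \<Rightarrow> nat \<Rightarrow> nat \<Rightarrow> real" where
  "urn_total \<sigma> W0 B0 n = real (W0 + B0) + real_of_int \<sigma> * real n"

definition lam1 :: "nat \<Rightarrow> real \<Rightarrow> real \<Rightarrow> real \<Rightarrow> real" where
  "lam1 m c T0 s = (real m * c + T0 - 1/2 + 1/2 * sqrt (1 + 4 * real m * c * (c + 1))) / s"

definition lam2 :: "nat \<Rightarrow> real \<Rightarrow> real \<Rightarrow> real \<Rightarrow> real" where
  "lam2 m c T0 s = (real m * c + T0 - 1/2 - 1/2 * sqrt (1 + 4 * real m * c * (c + 1))) / s"

definition mu1 :: "nat \<Rightarrow> real \<Rightarrow> real \<Rightarrow> real \<Rightarrow> real" where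
  "mu1 m c T0 s = (real m * c + T0 + c * sqrt (real m)) / s"

definition mu2 :: "nat \<Rightarrow> real \<Rightarrow> real \<Rightarrow> real \<Rightarrow> real" where
  "mu2 m c T0 s = (real m * c + T0 - c * sqrt (real m)) / s"

definition beta_without :: "nat \<Rightarrow> real \<Rightarrow> real \<Rightarrow> real \<Rightarrow> real" where
  "beta_without m c am T =
     c^2 * (real m / T - real m * (real m - 1) / (T * (T - 1))) + 2 * real m * am * c / T + 2 * am"

definition beta_with :: "nat \<Rightarrow> real \<Rightarrow> real \<Rightarrow> real \<Rightarrow> real" where
  "beta_with m c am T = c^2 * real m / T + 2 * real m * am * c / T + 2 * am"

definition bin :: "real \<Rightarrow> nat \<Rightarrow> real" where
  "bin x j = (real j - 1 + x) gchoose j"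

end

theory Submission
  imports Defs
begin

text \<open>
  For an affine urn a sample with \<open>k\<close> white balls adds \<open>k c + a\<^sub>m\<close> white balls, where
  \<open>c = a\<^sub>m\<^sub>-\<^sub>1 - a\<^sub>m\<close>. Conditioning on the past and inserting the first two factorial moments of the
  (hypergeometric or binomial) sample gives a first-order linear recurrence for the second moment
  of \<open>W\<^sub>n\<close>. The coefficient of \<open>E[(W\<^sub>n\<^sub>-\<^sub>1)\<^sup>2]\<close> is a ratio of quadratic polynomials in \<open>n\<close>; the roots of
  its numerator are \<open>1 - \<lambda>\<^sub>1, 1 - \<lambda>\<^sub>2\<close> (respectively \<open>1 - \<mu>\<^sub>1, 1 - \<mu>\<^sub>2\<close>), so that the product of
  these coefficients telescopes to a quotient of generalized binomial coefficients.
\<close>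

section \<open>Generalized binomial coefficients and first-order linear recurrences\<close>

lemma bin_0 [simp]: "bin x 0 = 1"
  by (simp add: bin_def)

text \<open>The shift by \<open>real j - 1\<close> in \<open>bin\<close> turns the falling factorial
  into a rising one starting at \<open>x\<close>, so raising \<open>j\<close> only appends the
  factor \<open>x + real j\<close>.\<close>

lemma bin_pochhammer: "bin x j = pochhammer x j / fact j"
  by (simp add: bin_def gbinomial_pochhammer')

lemma bin_Suc: "bin x (Suc j) = bin x j * ((x + real j) / real (Suc j))"
  by (simp add: bin_pochhammer pochhammer_Suc field_simps)

lemma bin_neq_0:
  assumes "\<And>i. i < j \<Longrightarrow> x + real i \<noteq> 0"
  shows "bin x j \<noteq> 0"
  using assms by (auto simp: bin_pochhammer pochhammer_eq_0_iff add_eq_0_iff2)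

text \<open>Variation of constants: \<open>Q\<close> solves the homogeneous recurrence, and dividing
  by it makes the differences of \<open>E j / Q j\<close> equal to \<open>h j / Q j\<close>. Stating
  the recurrence with quotients of \<open>Q\<close> lets the closed form of the product be inserted
  directly.\<close>

lemma linear_recurrence_closed_form:
  fixes E Q h :: "nat \<Rightarrow> real"
  assumes "\<And>j. j < n \<Longrightarrow> E (Suc j) = Q (Suc j) / Q j * E j + h (Suc j)"
    and "Q 0 = 1" and "\<And>j. j \<le> n \<Longrightarrow> Q j \<noteq> 0"
  shows "E n = Q n * (E 0 + (\<Sum>j=1..n. h j / Q j))"
  using assms
proof (induction n)
  case 0
  then show ?case by simp
next
  case (Suc n)
  have IH: "E n = Q n * (E 0 + (\<Sum>j=1..n. h j / Q j))"
    using Suc by simp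
  have "Q n \<noteq> 0" "Q (Suc n) \<noteq> 0"
    using Suc.prems(3) by auto
  moreover have "E (Suc n) = Q (Suc n) / Q n * E n + h (Suc n)"
    using Suc.prems(1) by simp
  ultimately show ?case
    by (simp add: IH distrib_left)
qed

section \<open>Moments of the sample drawn without replacement\<close>

text \<open>The term for \<open>k = 0\<close> vanishes; the shifted index is the one needed for
  absorption identities.\<close>

lemma sum_shift_mult_nat:
  fixes f :: "nat \<Rightarrow> real"
  shows "(\<Sum>k\<le>Suc m. real k * f k) = (\<Sum>k\<le>m. real (Suc k) * f (Suc k))"
  by (subst sum.atMost_Suc_shift) simp

text \<open>Absorbing \<open>k\<close> into \<open>W gchoose k\<close> lowers both indices and
  leaves a Vandermonde convolution of \<open>W - 1\<close> and \<open>B\<close>.\<close>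

lemma Vandermonde_first_moment:
  fixes W B :: real
  shows "(\<Sum>k\<le>Suc m. real k * ((W gchoose k) * (B gchoose (Suc m - k))))
    = W * ((W + B - 1) gchoose m)"
proof -
  have "(\<Sum>k\<le>Suc m. real k * ((W gchoose k) * (B gchoose (Suc m - k))))
      = (\<Sum>k\<le>m. W * (((W - 1) gchoose k) * (B gchoose (m - k))))"
    unfolding sum_shift_mult_nat
    using gbinomial_absorption[of _ W] by (auto intro!: sum.cong simp: mult.assoc[symmetric])
  also have "\<dots> = W * ((W - 1 + B) gchoose m)"
    using gbinomial_Vandermonde[of "W - 1" B m] by (simp add: sum_distrib_left[symmetric] atMost_atLeast0)
  finally show ?thesis
    by (simp add: algebra_simps)
qed

text \<open>One absorption reduces the sum to the first moment for \<open>W - 1\<close>, which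
  absorbs the remaining factor.\<close>

lemma Vandermonde_second_factorial_moment:
  fixes W B :: real
  shows "(\<Sum>k\<le>Suc (Suc m). real k * (real k - 1) * ((W gchoose k) * (B gchoose (Suc (Suc m) - k))))
    = W * (W - 1) * ((W + B - 2) gchoose m)"
proof -
  have absorb: "real (Suc k) * (W gchoose Suc k) = W * ((W - 1) gchoose k)" for k
    using gbinomial_absorption[of k W] by simp
  have "(\<Sum>k\<le>Suc (Suc m). real k * (real k - 1) * ((W gchoose k) * (B gchoose (Suc (Suc m) - k))))
      = (\<Sum>k\<le>Suc (Suc m). real k * ((real k - 1) * ((W gchoose k) * (B gchoose (Suc (Suc m) - k)))))"
    by (simp only: mult.assoc)
  also have "\<dots> = (\<Sum>k\<le>Suc m. real k * (B gchoose (Suc m - k)) * (real (Suc k) * (W gchoose Suc k)))"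
    unfolding sum_shift_mult_nat by (intro sum.cong) auto
  also have "\<dots> = W * (\<Sum>k\<le>Suc m. real k * (((W - 1) gchoose k) * (B gchoose (Suc m - k))))"
    unfolding absorb sum_distrib_left by (intro sum.cong) (auto simp: mult_ac)
  also have "\<dots> = W * (W - 1) * ((W + B - 2) gchoose m)"
    unfolding Vandermonde_first_moment by (simp add: algebra_simps)
  finally show ?thesis .
qed

text \<open>The Vandermonde sums are divided by \<open>T gchoose m\<close>; absorption applied to
  this denominator as well leaves rational functions of \<open>T\<close>.\<close>

lemma without_replacement_moments:
  fixes W B :: int and m :: nat
  defines "T \<equiv> real_of_int (W + B)" and "w \<equiv> real_of_int W"
  assumes "1 \<le> m" and size: "int m \<le> W + B"
  shows "(\<Sum>k\<le>m. without_replacement m W B k) = 1"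
    and "(\<Sum>k\<le>m. real k * without_replacement m W B k) = real m * w / T"
    and "(\<Sum>k\<le>m. real k * (real k - 1) * without_replacement m W B k)
      = real m * (real m - 1) * (w * (w - 1) / (T * (T - 1)))"
proof -
  have T: "T = w + real_of_int B" "real m \<le> T" "0 < T"
    using assms by (auto simp: T_def w_def)
  \<comment> \<open>The total is a natural number not below \<open>m\<close>, so this is an ordinary
    positive binomial coefficient.\<close>
  have nz: "(T gchoose m) \<noteq> 0"
  proof -
    have "T gchoose m = real (nat (W + B) choose m)"
      using size by (simp add: T_def binomial_gbinomial)
    then show ?thesis using size by (simp add: binomial_eq_0_iff)
  qed
  have wr: "without_replacement m W B k
      = ((w gchoose k) * (real_of_int B gchoose (m - k))) / (T gchoose m)" for k
    by (simp add: without_replacement_def T_def w_def)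
  show "(\<Sum>k\<le>m. without_replacement m W B k) = 1"
    using gbinomial_Vandermonde[of w "real_of_int B" m] nz
    by (simp add: wr sum_divide_distrib[symmetric] atMost_atLeast0 T(1))
  obtain m' where m': "m = Suc m'"
    using \<open>1 \<le> m\<close> by (cases m) auto
  have absorb: "real m * (T gchoose m) = T * ((T - 1) gchoose m')"
    using gbinomial_absorption[of m' T] m' by simp
  have "(\<Sum>k\<le>m. real k * without_replacement m W B k) = w * ((T - 1) gchoose m') / (T gchoose m)"
    using Vandermonde_first_moment[of w "real_of_int B" m']
    by (simp only: wr[unfolded m'] m' T(1) times_divide_eq_right sum_divide_distrib[symmetric])
  also have "\<dots> = real m * w / T"
    using nz T(3) absorb by (simp add: field_simps)
  finally show "(\<Sum>k\<le>m. real k * without_replacement m W B k) = real m * w / T" .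
  show "(\<Sum>k\<le>m. real k * (real k - 1) * without_replacement m W B k)
      = real m * (real m - 1) * (w * (w - 1) / (T * (T - 1)))"
  proof (cases m')
    \<comment> \<open>For \<open>m = 1\<close> both sides vanish through the factors
      \<open>real k - 1\<close> and \<open>real m - 1\<close>, which also covers
      \<open>T = 1\<close>, where the denominator is zero.\<close>
    case 0
    then show ?thesis by (simp add: m')
  next
    case (Suc m'')
    have "T - 1 > 0" using T(2) m' Suc by simp
    have "real m' * ((T - 1) gchoose m') = (T - 1) * ((T - 2) gchoose m'')"
      using gbinomial_absorption[of m'' "T - 1"] Suc by simp
    moreover have "real m * (real m - 1) * (T gchoose m) = real m' * (real m * (T gchoose m))"
      by (simp add: m')
    ultimately have absorb2: "real m * (real m - 1) * (T gchoose m)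
        = T * ((T - 1) * ((T - 2) gchoose m''))"
      by (simp only: absorb mult.left_commute[of "real m'"])
    have "(\<Sum>k\<le>m. real k * (real k - 1) * without_replacement m W B k)
        = w * (w - 1) * ((T - 2) gchoose m'') / (T gchoose m)"
      using Vandermonde_second_factorial_moment[of w "real_of_int B" m'']
      by (simp only: wr[unfolded m' Suc] m' Suc T(1) times_divide_eq_right sum_divide_distrib[symmetric])
    also have "\<dots> = w * (w - 1) * (real m * (real m - 1) * (T gchoose m)) / (T * (T - 1) * (T gchoose m))"
      unfolding absorb2 using \<open>T - 1 > 0\<close> T(3) by simp
    also have "\<dots> = real m * (real m - 1) * (w * (w - 1) / (T * (T - 1)))"
      using nz by (simp add: mult_ac)
    finally show ?thesis .
  qed
qed

section \<open>Moments of the sample drawn with replacement\<close>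

text \<open>Absorption in the binomial coefficient extracts \<open>real (Suc m) * W\<close>, and the
  binomial theorem sums the rest.\<close>

lemma binomial_first_moment:
  fixes W B :: real
  shows "(\<Sum>k\<le>Suc m. real k * (real (Suc m choose k) * W ^ k * B ^ (Suc m - k)))
    = real (Suc m) * W * (W + B) ^ m"
proof -
  have absorb: "real (Suc k) * real (Suc m choose Suc k) = real (Suc m) * real (m choose k)" for k
    by (metis Suc_times_binomial of_nat_mult)
  have "(\<Sum>k\<le>Suc m. real k * (real (Suc m choose k) * W ^ k * B ^ (Suc m - k)))
      = (\<Sum>k\<le>m. (real (Suc k) * real (Suc m choose Suc k)) * (W * W ^ k * B ^ (m - k)))"
    unfolding sum_shift_mult_nat by (intro sum.cong) (simp_all only: power_Suc diff_Suc_Suc mult_ac)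
  also have "\<dots> = (\<Sum>k\<le>m. real (Suc m) * W * (real (m choose k) * W ^ k * B ^ (m - k)))"
    unfolding absorb by (intro sum.cong) (simp_all only: mult_ac)
  also have "\<dots> = real (Suc m) * W * (W + B) ^ m"
    by (simp only: sum_distrib_left[symmetric] binomial_ring)
  finally show ?thesis .
qed

lemma binomial_second_factorial_moment:
  fixes W B :: real
  shows "(\<Sum>k\<le>Suc (Suc m). real k * (real k - 1) *
      (real (Suc (Suc m) choose k) * W ^ k * B ^ (Suc (Suc m) - k)))
    = real (Suc (Suc m)) * real (Suc m) * W ^ 2 * (W + B) ^ m"
proof -
  have absorb: "real (Suc k) * real (Suc (Suc m) choose Suc k)
      = real (Suc (Suc m)) * real (Suc m choose k)" for k
    by (metis Suc_times_binomial of_nat_mult)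
  have "(\<Sum>k\<le>Suc (Suc m). real k * (real k - 1) *
        (real (Suc (Suc m) choose k) * W ^ k * B ^ (Suc (Suc m) - k)))
      = (\<Sum>k\<le>Suc (Suc m). real k * ((real k - 1) *
        (real (Suc (Suc m) choose k) * W ^ k * B ^ (Suc (Suc m) - k))))"
    by (simp only: mult.assoc)
  also have "\<dots> = (\<Sum>k\<le>Suc m. (real (Suc k) * real (Suc (Suc m) choose Suc k)) *
        (W * (real k * W ^ k * B ^ (Suc m - k))))"
  proof -
    \<comment> \<open>After the index shift the factor \<open>real k - 1\<close> becomes
      \<open>real k\<close>, so a first moment for a sample smaller by one remains.\<close>
    have "real (Suc k) - 1 = real k" for k by simp
    then show ?thesis
      unfolding sum_shift_mult_nat
      by (intro sum.cong) (simp_all only: power_Suc diff_Suc_Suc mult_ac)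
  qed
  also have "\<dots> = real (Suc (Suc m)) * W *
      (\<Sum>k\<le>Suc m. real k * (real (Suc m choose k) * W ^ k * B ^ (Suc m - k)))"
    unfolding absorb sum_distrib_left by (intro sum.cong) (simp_all only: mult_ac)
  also have "\<dots> = real (Suc (Suc m)) * real (Suc m) * W ^ 2 * (W + B) ^ m"
    unfolding binomial_first_moment by (simp only: power2_eq_square mult_ac)
  finally show ?thesis .
qed

lemma with_replacement_moments:
  fixes W B :: int and m :: nat
  defines "T \<equiv> real_of_int (W + B)" and "w \<equiv> real_of_int W"
  assumes "1 \<le> m" and size: "W + B \<noteq> 0"
  shows "(\<Sum>k\<le>m. with_replacement m W B k) = 1"
    and "(\<Sum>k\<le>m. real k * with_replacement m W B k) = real m * w / T"
    and "(\<Sum>k\<le>m. real k * (real k - 1) * with_replacement m W B k)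
      = real m * (real m - 1) * (w ^ 2 / T ^ 2)"
proof -
  have T: "T = w + real_of_int B" "T \<noteq> 0"
    using size by (auto simp: T_def w_def simp flip: of_int_add)
  have wr: "with_replacement m W B k
      = (real (m choose k) * w ^ k * real_of_int B ^ (m - k)) / T ^ m" for k
    by (simp add: with_replacement_def T_def w_def)
  show "(\<Sum>k\<le>m. with_replacement m W B k) = 1"
    using T by (simp only: wr sum_divide_distrib[symmetric] binomial_ring[symmetric]) simp
  obtain m' where m': "m = Suc m'"
    using \<open>1 \<le> m\<close> by (cases m) auto
  have "(\<Sum>k\<le>m. real k * with_replacement m W B k) = real m * w * T ^ m' / T ^ m"
    using binomial_first_moment[of m' w "real_of_int B"]
    by (simp only: wr[unfolded m'] m' T(1) times_divide_eq_right sum_divide_distrib[symmetric])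
  also have "\<dots> = real m * w / T"
    using T(2) by (simp add: m')
  finally show "(\<Sum>k\<le>m. real k * with_replacement m W B k) = real m * w / T" .
  show "(\<Sum>k\<le>m. real k * (real k - 1) * with_replacement m W B k)
      = real m * (real m - 1) * (w ^ 2 / T ^ 2)"
  proof (cases m')
    case 0
    then show ?thesis by (simp add: m')
  next
    case (Suc m'')
    have "(\<Sum>k\<le>m. real k * (real k - 1) * with_replacement m W B k)
        = real m * real m' * w ^ 2 * T ^ m'' / T ^ m"
      using binomial_second_factorial_moment[of m'' w "real_of_int B"]
      by (simp only: wr[unfolded m' Suc] m' Suc T(1) times_divide_eq_right sum_divide_distrib[symmetric])
    also have "\<dots> = real m * (real m - 1) * (w ^ 2 / T ^ 2)"
      using T(2) by (simp add: m' Suc power2_eq_square)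
    finally show ?thesis .
  qed
qed

section \<open>Measurability, integrability and conditioning on the past draws\<close>

lemma balls_0 [simp]: "balls m a W0 X 0 \<omega> = int W0"
  by (simp add: balls_def)

lemma balls_Suc: "balls m a W0 X (Suc n) \<omega> = balls m a W0 X n \<omega> + a (m - X (Suc n) \<omega>)"
  by (simp add: balls_def)

context urn_process
begin

lemma space_draws_field [simp]: "space (draws_field P X n) = space P"
  by (simp add: draws_field_def space_measure_of_conv)

lemma sets_draws_field:
  "sets (draws_field P X n) = sigma_sets (space P) {X i -` A \<inter> space P | i A. 1 \<le> i \<and> i \<le> n}"
  unfolding draws_field_def by (rule sets_measure_of) auto

lemma subalgebra_draws_field: "subalgebra P (draws_field P X n)"
proof -
  have "sigma_sets (space P) {X i -` A \<inter> space P | i A. 1 \<le> i \<and> i \<le> n} \<subseteq> sets P"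
    using draw_measurable by (intro sets.sigma_sets_subset) (auto intro!: measurable_sets)
  then show ?thesis
    by (simp add: subalgebra_def sets_draws_field)
qed

text \<open>Finiteness of \<open>P\<close> passes to its restriction to any sub-sigma-field; this
  gives access to the calculus of \<open>real_cond_exp\<close> for every \<open>n\<close>.\<close>

sublocale draws: sigma_finite_subalgebra P "draws_field P X n" for n
proof -
  interpret finite_measure_subalgebra P "draws_field P X n"
    by unfold_locales (rule subalgebra_draws_field)
  show "sigma_finite_subalgebra P (draws_field P X n)"
    by unfold_locales
qed

lemma measurable_draw_draws_field:
  "1 \<le> i \<Longrightarrow> i \<le> n \<Longrightarrow> X i \<in> measurable (draws_field P X n) (count_space UNIV)"
  by (rule measurableI) (auto simp: sets_draws_field intro!: sigma_sets.Basic)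

lemma measurable_balls_draws_field:
  "i \<le> n \<Longrightarrow> balls m a' V X i \<in> measurable (draws_field P X n) (count_space UNIV)"
proof (induction i)
  case 0
  then show ?case by (simp add: balls_def cong: measurable_cong)
next
  case (Suc i)
  have X: "X (Suc i) \<in> measurable (draws_field P X n) (count_space UNIV)"
    using Suc.prems by (intro measurable_draw_draws_field) auto
  have B: "balls m a' V X i \<in> measurable (draws_field P X n) (count_space UNIV)"
    using Suc by simp
  \<comment> \<open>The contents take countably many values, so it suffices to treat each fixed
    value \<open>x\<close> of the first summand.\<close>
  have "(\<lambda>\<omega>. balls m a' V X i \<omega> + a' (m - X (Suc i) \<omega>))
      \<in> measurable (draws_field P X n) (count_space UNIV)"
  proof (rule measurable_compose_countable[OF _ B])
    show "(\<lambda>\<omega>. x + a' (m - X (Suc i) \<omega>)) \<in> measurable (draws_field P X n) (count_space UNIV)" for x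
      by (rule measurable_compose[OF X]) simp
  qed
  then show ?case by (simp add: balls_Suc[abs_def])
qed

lemma measurable_balls: "balls m a' V X n \<in> measurable P (count_space UNIV)"
  using measurable_from_subalg[OF subalgebra_draws_field measurable_balls_draws_field] by blast

text \<open>Each draw has at most \<open>m + 1\<close> possible outcomes. Consequently every real
  function of the contents is bounded, hence integrable.\<close>

lemma finite_range_balls: "finite (balls m a' V X n ` space P)"
proof (induction n)
  case 0
  then show ?case by (rule finite_subset[of _ "{int V}"]) auto
next
  case (Suc n)
  have "balls m a' V X (Suc n) ` space P
      \<subseteq> (\<lambda>(x, k). x + a' (m - k)) ` (balls m a' V X n ` space P \<times> {..m})"
    using draw_le by (fastforce simp: balls_Suc)
  then show ?case
    by (rule finite_subset) (use Suc in auto)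
qed

lemma integrable_balls:
  fixes f :: "int \<Rightarrow> real"
  shows "integrable P (\<lambda>\<omega>. f (balls m a' V X n \<omega>))"
proof (rule integrable_const_bound)
  show "AE \<omega> in P. norm (f (balls m a' V X n \<omega>))
      \<le> Max ((\<lambda>x. norm (f x)) ` balls m a' V X n ` space P)"
    using finite_range_balls by (intro AE_I2 Max_ge) auto
  show "(\<lambda>\<omega>. f (balls m a' V X n \<omega>)) \<in> borel_measurable P"
    by (rule measurable_compose[OF measurable_balls]) simp
qed

text \<open>The expectation is split according to the value \<open>k\<close> of the next draw. Since
  \<open>f (W \<omega>) k\<close> depends on the past only, the indicator of that value may be
  replaced by its conditional expectation, which the draw law identifies.\<close>

lemma expectation_next_draw:
  fixes f :: "int \<Rightarrow> nat \<Rightarrow> real" and n :: nat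
  defines "W \<equiv> balls m a W0 X n" and "B \<equiv> balls m b B0 X n"
  shows "expectation (\<lambda>\<omega>. f (W \<omega>) (X (Suc n) \<omega>))
    = expectation (\<lambda>\<omega>. \<Sum>k\<le>m. f (W \<omega>) k * p m (W \<omega>) (B \<omega>) k)"
proof -
  let ?D = "\<lambda>k. {\<omega> \<in> space P. X (Suc n) \<omega> = k}"
  let ?C = "\<lambda>k. real_cond_exp P (draws_field P X n) (indicator (?D k))"
  have D: "?D k \<in> sets P" for k
  proof -
    have "X (Suc n) -` {k} \<inter> space P \<in> sets P"
      using draw_measurable by (rule measurable_sets) auto
    then show ?thesis by (simp add: vimage_def Int_def conj_commute)
  qed
  have fD: "integrable P (\<lambda>\<omega>. f (W \<omega>) k * indicator (?D k) \<omega>)" for k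
    unfolding W_def using integrable_balls D by (rule integrable_real_mult_indicator[rotated])
  have fF: "(\<lambda>\<omega>. f (W \<omega>) k) \<in> borel_measurable (draws_field P X n)" for k
    unfolding W_def by (rule measurable_compose[OF measurable_balls_draws_field]) auto
  \<comment> \<open>Defining property of conditional expectation, tested against the past-measurable
    factor \<open>f (W \<omega>) k\<close>.\<close>
  have fC: "integrable P (\<lambda>\<omega>. f (W \<omega>) k * ?C k \<omega>)"
    "expectation (\<lambda>\<omega>. f (W \<omega>) k * ?C k \<omega>) = expectation (\<lambda>\<omega>. f (W \<omega>) k * indicator (?D k) \<omega>)" for k
    using draws.real_cond_exp_intg[OF fD fF] D by auto
  have law: "AE \<omega> in P. f (W \<omega>) k * ?C k \<omega> = f (W \<omega>) k * p m (W \<omega>) (B \<omega>) k" if "k \<le> m" for k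
    using draw_law[of "Suc n" k] that by (auto simp: W_def B_def)
  \<comment> \<open>The identity \<open>law\<close> holds only almost everywhere, so measurability
    of its right-hand side is shown separately, again from the integer values of the
    contents.\<close>
  have fp: "(\<lambda>\<omega>. f (W \<omega>) k * p m (W \<omega>) (B \<omega>) k) \<in> borel_measurable P" for k
    unfolding W_def B_def
    by (rule measurable_compose_countable[OF measurable_compose[OF measurable_balls] measurable_balls]) auto
  have "expectation (\<lambda>\<omega>. f (W \<omega>) (X (Suc n) \<omega>))
      = expectation (\<lambda>\<omega>. \<Sum>k\<le>m. f (W \<omega>) k * indicator (?D k) \<omega>)"
  proof (rule Bochner_Integration.integral_cong)
    fix \<omega> assume "\<omega> \<in> space P"
    then show "f (W \<omega>) (X (Suc n) \<omega>) = (\<Sum>k\<le>m. f (W \<omega>) k * indicator (?D k) \<omega>)"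
      using draw_le[of "Suc n" \<omega>] by (simp add: indicator_def if_distrib sum.delta cong: if_cong)
  qed simp
  also have "\<dots> = (\<Sum>k\<le>m. expectation (\<lambda>\<omega>. f (W \<omega>) k * ?C k \<omega>))"
    unfolding fC(2) by (rule Bochner_Integration.integral_sum) (rule fD)
  also have "\<dots> = (\<Sum>k\<le>m. expectation (\<lambda>\<omega>. f (W \<omega>) k * p m (W \<omega>) (B \<omega>) k))"
    using law fp borel_measurable_integrable[OF fC(1)]
    by (intro sum.cong refl integral_cong_AE) auto
  also have "\<dots> = expectation (\<lambda>\<omega>. \<Sum>k\<le>m. f (W \<omega>) k * p m (W \<omega>) (B \<omega>) k)"
  proof (rule Bochner_Integration.integral_sum[symmetric])
    fix k assume "k \<in> {..m}"
    then show "integrable P (\<lambda>\<omega>. f (W \<omega>) k * p m (W \<omega>) (B \<omega>) k)"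
      using integrable_cong_AE[OF borel_measurable_integrable[OF fC(1)] fp law] fC(1) by auto
  qed
  finally show ?thesis .
qed

end

section \<open>The recurrence for the second moment and the nonzero denominators\<close>

locale affine_urn_process = balanced_affine_urn m a b \<sigma> W0 B0 + urn_process P p m a b W0 B0 X
  for P :: "'s measure" and p m a b \<sigma> W0 B0 X
begin

text \<open>Balance is used draw by draw. The total is deterministic, so the denominators in the
  sample moments are constants under the expectation.\<close>

lemma total_balls:
  assumes "\<omega> \<in> space P"
  shows "balls m a W0 X n \<omega> + balls m b B0 X n \<omega> = int (W0 + B0) + \<sigma> * int n"
proof (induction n)
  case (Suc n)
  have "a (m - X (Suc n) \<omega>) + b (m - X (Suc n) \<omega>) = \<sigma>"
    by (rule balanced) simp
  with Suc show ?case by (simp add: balls_Suc algebra_simps)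
qed simp

text \<open>Linearity in the number of white balls drawn is why the first two moments of the sample
  suffice.\<close>

lemma replacement_affine:
  "k \<le> m \<Longrightarrow> a (m - k) = int k * (a (m - 1) - a m) + a m"
  using affine[of "m - k"] by (simp add: of_nat_diff algebra_simps)

text \<open>
  The two models differ only in the second factorial moment of the sample, which for both is a
  quadratic polynomial in the number of white balls without constant term.
\<close>

lemma second_moment_step:
  fixes n :: nat and u v :: real
  defines "c \<equiv> real_of_int (a (m - 1) - a m)" and "am \<equiv> real_of_int (a m)"
    and "T \<equiv> urn_total \<sigma> W0 B0 n"
    and "W \<equiv> (\<lambda>j \<omega>. real_of_int (balls m a W0 X j \<omega>))"
  assumes p0: "\<And>w z. w + z = int (W0 + B0) + \<sigma> * int n \<Longrightarrow> (\<Sum>k\<le>m. p m w z k) = 1"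
    and p1: "\<And>w z. w + z = int (W0 + B0) + \<sigma> * int n \<Longrightarrow>
      (\<Sum>k\<le>m. real k * p m w z k) = real m * real_of_int w / T"
    and p2: "\<And>w z. w + z = int (W0 + B0) + \<sigma> * int n \<Longrightarrow>
      (\<Sum>k\<le>m. real k * (real k - 1) * p m w z k)
        = real m * (real m - 1) * (u * (real_of_int w)^2 - v * real_of_int w)"
  shows "expectation (\<lambda>\<omega>. (W (Suc n) \<omega>)^2)
    = (1 + 2 * c * real m / T + c^2 * (real m * (real m - 1) * u)) * expectation (\<lambda>\<omega>. (W n \<omega>)^2)
      + (c^2 * (real m / T - real m * (real m - 1) * v) + 2 * real m * am * c / T + 2 * am)
        * expectation (W n) + am^2"
    (is "_ = ?A * _ + ?B * _ + _")
proof -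
  let ?p = "\<lambda>\<omega>. p m (balls m a W0 X n \<omega>) (balls m b B0 X n \<omega>)"
  have "expectation (\<lambda>\<omega>. (W (Suc n) \<omega>)^2)
      = expectation (\<lambda>\<omega>. (W n \<omega> + (real (X (Suc n) \<omega>) * c + am))^2)"
  proof (rule Bochner_Integration.integral_cong)
    fix \<omega> assume "\<omega> \<in> space P"
    then show "(W (Suc n) \<omega>)^2 = (W n \<omega> + (real (X (Suc n) \<omega>) * c + am))^2"
      using draw_le[of "Suc n" \<omega>]
      by (simp add: W_def balls_Suc replacement_affine c_def am_def)
  qed simp
  also have "\<dots> = expectation (\<lambda>\<omega>. \<Sum>k\<le>m. (W n \<omega> + (real k * c + am))^2 * ?p \<omega> k)"
    unfolding W_def by (rule expectation_next_draw)
  also have "\<dots> = expectation (\<lambda>\<omega>. ?A * (W n \<omega>)^2 + ?B * W n \<omega> + am^2)"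
  proof (rule Bochner_Integration.integral_cong)
    fix \<omega> assume "\<omega> \<in> space P"
    note total = total_balls[OF this]
    \<comment> \<open>The square is expanded with \<open>k^2 = k * (k - 1) + k\<close>, so that
      exactly the factorial moments from the hypotheses appear.\<close>
    have "(\<Sum>k\<le>m. (W n \<omega> + (real k * c + am))^2 * ?p \<omega> k)
        = (\<Sum>k\<le>m. (W n \<omega> + am)^2 * ?p \<omega> k + (2 * (W n \<omega> + am) * c + c^2) * (real k * ?p \<omega> k)
            + c^2 * (real k * (real k - 1) * ?p \<omega> k))"
      by (intro sum.cong) (auto simp: power2_eq_square algebra_simps)
    also have "\<dots> = (W n \<omega> + am)^2 * (\<Sum>k\<le>m. ?p \<omega> k)
        + (2 * (W n \<omega> + am) * c + c^2) * (\<Sum>k\<le>m. real k * ?p \<omega> k)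
        + c^2 * (\<Sum>k\<le>m. real k * (real k - 1) * ?p \<omega> k)"
      by (simp only: sum.distrib sum_distrib_left)
    also have "\<dots> = ?A * (W n \<omega>)^2 + ?B * W n \<omega> + am^2"
      unfolding p0[OF total] p1[OF total] p2[OF total] W_def
      by (simp add: power2_eq_square algebra_simps add_divide_distrib)
    finally show "(\<Sum>k\<le>m. (W n \<omega> + (real k * c + am))^2 * ?p \<omega> k)
        = ?A * (W n \<omega>)^2 + ?B * W n \<omega> + am^2" .
  qed simp
  also have "\<dots> = ?A * expectation (\<lambda>\<omega>. (W n \<omega>)^2) + ?B * expectation (W n) + am^2"
  proof -
    have "integrable P (\<lambda>\<omega>. (W n \<omega>)^2)" "integrable P (W n)"
      unfolding W_def using integrable_balls[of "\<lambda>x. (real_of_int x)^2"]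
        integrable_balls[of real_of_int] by auto
    then show ?thesis by (simp add: prob_space)
  qed
  finally show ?thesis .
qed

lemma urn_total_eq: "urn_total \<sigma> W0 B0 n = real_of_int (int (W0 + B0) + \<sigma> * int n)"
  by (simp add: urn_total_def)

lemma urn_total_ge: "int m \<le> int (W0 + B0) + \<sigma> * int n"
proof -
  have "0 \<le> \<sigma> * int n" using balance_pos by simp
  then show ?thesis using initial_size by linarith
qed

lemma urn_total_pos: "0 < urn_total \<sigma> W0 B0 n"
  using urn_total_ge[of n] sample_size unfolding urn_total_eq by linarith

lemma bin_initial_total:
  "bin (urn_total \<sigma> W0 B0 0 / real_of_int \<sigma>) j \<noteq> 0"
proof (rule bin_neq_0)
  fix i
  have "0 < urn_total \<sigma> W0 B0 0 / real_of_int \<sigma>"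
    using urn_total_pos balance_pos by simp
  then show "urn_total \<sigma> W0 B0 0 / real_of_int \<sigma> + real i \<noteq> 0" by linarith
qed

text \<open>The \<open>i\<close>-th factor of the rising factorial is
  \<open>(urn_total \<sigma> W0 B0 i - 1) / real_of_int \<sigma>\<close>. It can vanish only for
  \<open>i = 0\<close> with a single initial ball.\<close>

lemma bin_initial_total_minus_1:
  assumes "\<And>i. i < j \<Longrightarrow> urn_total \<sigma> W0 B0 i \<noteq> 1"
  shows "bin ((urn_total \<sigma> W0 B0 0 - 1) / real_of_int \<sigma>) j \<noteq> 0"
proof (rule bin_neq_0)
  fix i assume "i < j"
  then have "urn_total \<sigma> W0 B0 i \<noteq> 1" by (rule assms)
  then show "(urn_total \<sigma> W0 B0 0 - 1) / real_of_int \<sigma> + real i \<noteq> 0"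
    using balance_pos by (auto simp: urn_total_def field_simps)
qed

end

section \<open>Factorization of the recurrence coefficients\<close>

text \<open>The two factors are conjugate, so their product is a difference of squares without the
  root. The right-hand side is the coefficient of the second moment multiplied by
  \<open>T * (T - 1)\<close>.\<close>

lemma lam_factors:
  fixes c :: int and T0 s :: real and j :: nat
  assumes "s \<noteq> 0"
  defines "T \<equiv> T0 + s * real j"
  shows "s^2 * ((lam1 m c T0 s + real j) * (lam2 m c T0 s + real j))
    = T * (T - 1) + 2 * c * real m * (T - 1) + (real_of_int c)^2 * (real m * (real m - 1))"
proof -
  define r where "r = sqrt (1 + 4 * real m * c * (real_of_int c + 1))"
  \<comment> \<open>Integrality of \<open>c\<close> enters here: the product would be negative for
    real \<open>c\<close> strictly between -1 and 0. Nonnegativity of the radicand makes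
    \<open>r\<close> a true square root.\<close>
  have "0 \<le> c * (c + 1)"
    by (cases "0 \<le> c") (auto simp: zero_le_mult_iff)
  then have "0 \<le> real_of_int (c * (c + 1))"
    by (simp only: of_int_0_le_iff)
  then have "0 \<le> real m * real_of_int (c * (c + 1))" by simp
  then have r2: "r^2 = 1 + 4 * real m * c * (real_of_int c + 1)"
    unfolding r_def by (subst real_sqrt_pow2) (auto simp: algebra_simps)
  have "s^2 * ((lam1 m c T0 s + real j) * (lam2 m c T0 s + real j))
      = (s * (lam1 m c T0 s + real j)) * (s * (lam2 m c T0 s + real j))"
    by (simp add: power2_eq_square algebra_simps)
  also have "s * (lam1 m c T0 s + real j) = real m * c + T - 1/2 + 1/2 * r"
    using \<open>s \<noteq> 0\<close> by (simp add: lam1_def r_def T_def distrib_left[of s _ "real j"])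
  also have "s * (lam2 m c T0 s + real j) = real m * c + T - 1/2 - 1/2 * r"
    using \<open>s \<noteq> 0\<close> by (simp add: lam2_def r_def T_def distrib_left[of s _ "real j"])
  finally have "s^2 * ((lam1 m c T0 s + real j) * (lam2 m c T0 s + real j))
      = (real m * c + T - 1/2 + 1/2 * r) * (real m * c + T - 1/2 - 1/2 * r)" .
  also have "\<dots> = (real m * c + T - 1/2)^2 - r^2 / 4"
    by (simp add: power2_eq_square algebra_simps)
  also have "\<dots> = T * (T - 1) + 2 * c * real m * (T - 1) + (real_of_int c)^2 * (real m * (real m - 1))"
    unfolding r2 by (simp add: power2_eq_square field_simps)
  finally show ?thesis .
qed

text \<open>Again a difference of squares; the right-hand side is the coefficient for replacement
  multiplied by \<open>T^2\<close>.\<close>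

lemma mu_factors:
  fixes c T0 s :: real and j :: nat
  assumes "s \<noteq> 0"
  defines "T \<equiv> T0 + s * real j"
  shows "s^2 * ((mu1 m c T0 s + real j) * (mu2 m c T0 s + real j))
    = T^2 + 2 * c * real m * T + c^2 * (real m * (real m - 1))"
proof -
  have "s^2 * ((mu1 m c T0 s + real j) * (mu2 m c T0 s + real j))
      = (s * (mu1 m c T0 s + real j)) * (s * (mu2 m c T0 s + real j))"
    by (simp add: power2_eq_square algebra_simps)
  also have "s * (mu1 m c T0 s + real j) = real m * c + T + c * sqrt m"
    using \<open>s \<noteq> 0\<close> by (simp add: mu1_def T_def distrib_left[of s _ "real j"])
  also have "s * (mu2 m c T0 s + real j) = real m * c + T - c * sqrt m"
    using \<open>s \<noteq> 0\<close> by (simp add: mu2_def T_def distrib_left[of s _ "real j"])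
  finally have "s^2 * ((mu1 m c T0 s + real j) * (mu2 m c T0 s + real j))
      = (real m * c + T + c * sqrt m) * (real m * c + T - c * sqrt m)" .
  also have "\<dots> = (real m * c + T)^2 - c^2 * (sqrt m)^2"
    by (simp add: power2_eq_square algebra_simps)
  also have "\<dots> = T^2 + 2 * c * real m * T + c^2 * (real m * (real m - 1))"
    by (simp add: power2_eq_square algebra_simps)
  finally show ?thesis .
qed

text \<open>The factors \<open>real (Suc j)\<close> from \<open>bin_Suc\<close> cancel. Expanding by
  \<open>s^2\<close> turns the shifted parameters in the denominator into ball totals.\<close>

lemma bin_ratio_Suc:
  assumes "bin x j \<noteq> 0" "bin y j \<noteq> 0" "bin x' j \<noteq> 0" "bin y' j \<noteq> 0" "s \<noteq> 0"
  shows "(bin x (Suc j) * bin y (Suc j) / (bin x' (Suc j) * bin y' (Suc j)))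
      / (bin x j * bin y j / (bin x' j * bin y' j))
    = (s^2 * ((x + real j) * (y + real j))) / ((s * (x' + real j)) * (s * (y' + real j)))"
  using assms by (simp add: bin_Suc power2_eq_square divide_simps)

section \<open>Closed forms in the two models\<close>

lemma (in affine_urn_process) second_moment_without_replacement:
  fixes n :: nat
  defines "c \<equiv> real_of_int (a (m - 1) - a m)" and "am \<equiv> real_of_int (a m)"
    and "s \<equiv> real_of_int \<sigma>" and "T \<equiv> urn_total \<sigma> W0 B0"
    and "W \<equiv> (\<lambda>j \<omega>. real_of_int (balls m a W0 X j \<omega>))"
  defines "l1 \<equiv> lam1 m c (T 0) s" and "l2 \<equiv> lam2 m c (T 0) s"
  assumes p: "p = without_replacement"
    and nz: "\<And>j. 1 \<le> j \<Longrightarrow> j \<le> n \<Longrightarrow> T (j - 1) \<noteq> 1 \<and> bin l1 j \<noteq> 0 \<and> bin l2 j \<noteq> 0"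
  shows "expectation (\<lambda>\<omega>. (W n \<omega>)^2) =
    bin l1 n * bin l2 n / (bin (T 0 / s) n * bin ((T 0 - 1) / s) n) *
      ((real W0)^2 + (\<Sum>j=1..n.
        (beta_without m c am (T (j - 1)) * expectation (W (j - 1)) + am^2) *
        bin (T 0 / s) j * bin ((T 0 - 1) / s) j / (bin l1 j * bin l2 j)))"
proof -
  \<comment> \<open>\<open>Q j\<close> is the telescoped product of the first \<open>j\<close>
    recurrence coefficients, as \<open>Q_step\<close> confirms.\<close>
  define Q where "Q j = bin l1 j * bin l2 j / (bin (T 0 / s) j * bin ((T 0 - 1) / s) j)" for j
  define h where "h j = beta_without m c am (T (j - 1)) * expectation (W (j - 1)) + am^2" for j
  have s: "s > 0" using balance_pos by (simp add: s_def)
  have T1: "T j \<noteq> 1" if "j < n" for j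
    using nz[of "Suc j"] that by simp
  have T0: "T j > 0" for j
    unfolding T_def by (rule urn_total_pos)
  have bins: "bin l1 j \<noteq> 0" "bin l2 j \<noteq> 0" "bin (T 0 / s) j \<noteq> 0" "bin ((T 0 - 1) / s) j \<noteq> 0"
    if "j \<le> n" for j
  proof -
    show "bin l1 j \<noteq> 0" "bin l2 j \<noteq> 0"
      \<comment> \<open>The hypothesis starts at \<open>j = 1\<close>; for \<open>j = 0\<close> the
        value of \<open>bin\<close> is 1.\<close>
      using nz[of j] that by (cases j; simp)+
    show "bin (T 0 / s) j \<noteq> 0"
      unfolding T_def s_def by (rule bin_initial_total)
    show "bin ((T 0 - 1) / s) j \<noteq> 0"
      unfolding T_def s_def using T1 that by (intro bin_initial_total_minus_1) (auto simp: T_def)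
  qed
  have Q_step: "Q (Suc j) / Q j
      = 1 + 2 * c * real m / T j + c^2 * (real m * (real m - 1) * (1 / (T j * (T j - 1))))"
    if "j < n" for j
  proof -
    have Tj: "T j = T 0 + s * real j"
      by (simp add: T_def s_def urn_total_def)
    have st: "s * (T 0 / s + real j) = T j" "s * ((T 0 - 1) / s + real j) = T j - 1"
      using s by (simp_all add: Tj distrib_left)
    have "Q (Suc j) / Q j = (s^2 * ((l1 + real j) * (l2 + real j))) / (T j * (T j - 1))"
      unfolding Q_def using bins[of j] that s
      by (subst bin_ratio_Suc[where s = s]) (auto simp: st)
    also have "\<dots> = (T j * (T j - 1) + 2 * c * real m * (T j - 1) + c^2 * (real m * (real m - 1)))
        / (T j * (T j - 1))"
      using lam_factors[of s m "a (m - 1) - a m" "T 0" j] s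
      by (simp add: l1_def l2_def c_def Tj)
    also have "\<dots> = 1 + 2 * c * real m / T j + c^2 * (real m * (real m - 1) * (1 / (T j * (T j - 1))))"
      using T1[OF that] T0[of j] by (simp add: add_divide_distrib)
    finally show ?thesis .
  qed
  have "expectation (\<lambda>\<omega>. (W n \<omega>)^2)
      = Q n * (expectation (\<lambda>\<omega>. (W 0 \<omega>)^2) + (\<Sum>j=1..n. h j / Q j))"
  proof (rule linear_recurrence_closed_form)
    fix j assume j: "j < n"
    \<comment> \<open>Here \<open>second_moment_step\<close> is used with \<open>u\<close> and
      \<open>v\<close> both equal to \<open>1 / (T j * (T j - 1))\<close>, from the hypergeometric
      \<open>w * (w - 1)\<close>.\<close>
    have "expectation (\<lambda>\<omega>. (W (Suc j) \<omega>)^2)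
        = (1 + 2 * c * real m / T j + c^2 * (real m * (real m - 1) * (1 / (T j * (T j - 1)))))
            * expectation (\<lambda>\<omega>. (W j \<omega>)^2)
          + (c^2 * (real m / T j - real m * (real m - 1) * (1 / (T j * (T j - 1))))
              + 2 * real m * am * c / T j + 2 * am) * expectation (W j) + am^2"
      unfolding c_def am_def T_def W_def
    proof (rule second_moment_step)
      fix w z assume wz: "w + z = int (W0 + B0) + \<sigma> * int j"
      have size: "int m \<le> w + z" using urn_total_ge wz by simp
      have Twz: "urn_total \<sigma> W0 B0 j = real_of_int (w + z)" by (simp only: urn_total_eq wz)
      note moments = without_replacement_moments[OF sample_size size]
      show "(\<Sum>k\<le>m. p m w z k) = 1"
        unfolding p by (rule moments)
      show "(\<Sum>k\<le>m. real k * p m w z k) = real m * real_of_int w / urn_total \<sigma> W0 B0 j"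
        unfolding p Twz by (rule moments)
      show "(\<Sum>k\<le>m. real k * (real k - 1) * p m w z k) = real m * (real m - 1) *
          (1 / (urn_total \<sigma> W0 B0 j * (urn_total \<sigma> W0 B0 j - 1)) * (real_of_int w)^2
            - 1 / (urn_total \<sigma> W0 B0 j * (urn_total \<sigma> W0 B0 j - 1)) * real_of_int w)"
        unfolding p Twz moments(3)
        by (simp add: power2_eq_square right_diff_distrib diff_divide_distrib)
    qed
    then show "expectation (\<lambda>\<omega>. (W (Suc j) \<omega>)^2)
        = Q (Suc j) / Q j * expectation (\<lambda>\<omega>. (W j \<omega>)^2) + h (Suc j)"
      by (simp add: Q_step[OF j] h_def beta_without_def)
  qed (use bins in \<open>auto simp: Q_def\<close>)
  \<comment> \<open>The initial content is constant, so its second moment is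
    \<open>(real W0)^2\<close>; division by \<open>Q j\<close> inverts the quotient of binomials
    inside the sum.\<close>
  then show ?thesis
    by (simp add: Q_def h_def W_def prob_space mult.assoc)
qed

lemma (in affine_urn_process) second_moment_with_replacement:
  fixes n :: nat
  defines "c \<equiv> real_of_int (a (m - 1) - a m)" and "am \<equiv> real_of_int (a m)"
    and "s \<equiv> real_of_int \<sigma>" and "T \<equiv> urn_total \<sigma> W0 B0"
    and "W \<equiv> (\<lambda>j \<omega>. real_of_int (balls m a W0 X j \<omega>))"
  defines "u1 \<equiv> mu1 m c (T 0) s" and "u2 \<equiv> mu2 m c (T 0) s"
  assumes p: "p = with_replacement"
    and nz: "\<And>j. 1 \<le> j \<Longrightarrow> j \<le> n \<Longrightarrow> bin u1 j \<noteq> 0 \<and> bin u2 j \<noteq> 0"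
  shows "expectation (\<lambda>\<omega>. (W n \<omega>)^2) =
    bin u1 n * bin u2 n / (bin (T 0 / s) n)^2 *
      ((real W0)^2 + (\<Sum>j=1..n.
        (beta_with m c am (T (j - 1)) * expectation (W (j - 1)) + am^2) *
        (bin (T 0 / s) j)^2 / (bin u1 j * bin u2 j)))"
proof -
  define Q where "Q j = bin u1 j * bin u2 j / (bin (T 0 / s) j * bin (T 0 / s) j)" for j
  define h where "h j = beta_with m c am (T (j - 1)) * expectation (W (j - 1)) + am^2" for j
  have s: "s > 0" using balance_pos by (simp add: s_def)
  have T0: "T j > 0" for j
    unfolding T_def by (rule urn_total_pos)
  have bins: "bin u1 j \<noteq> 0" "bin u2 j \<noteq> 0" "bin (T 0 / s) j \<noteq> 0" if "j \<le> n" for j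
  proof -
    show "bin u1 j \<noteq> 0" "bin u2 j \<noteq> 0"
      using nz[of j] that by (cases j; simp)+
    show "bin (T 0 / s) j \<noteq> 0"
      unfolding T_def s_def by (rule bin_initial_total)
  qed
  have Q_step: "Q (Suc j) / Q j
      = 1 + 2 * c * real m / T j + c^2 * (real m * (real m - 1) * (1 / (T j)^2))"
    if "j < n" for j
  proof -
    have Tj: "T j = T 0 + s * real j"
      by (simp add: T_def s_def urn_total_def)
    have st: "s * (T 0 / s + real j) = T j"
      using s by (simp add: Tj distrib_left)
    have "Q (Suc j) / Q j = (s^2 * ((u1 + real j) * (u2 + real j))) / (T j * T j)"
      unfolding Q_def using bins[of j] that s
      by (subst bin_ratio_Suc[where s = s]) (auto simp: st)
    also have "\<dots> = ((T j)^2 + 2 * c * real m * T j + c^2 * (real m * (real m - 1))) / (T j)^2"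
      using mu_factors[of s m c "T 0" j] s
      by (simp add: u1_def u2_def Tj power2_eq_square)
    also have "\<dots> = 1 + 2 * c * real m / T j + c^2 * (real m * (real m - 1) * (1 / (T j)^2))"
      using T0[of j] by (simp add: add_divide_distrib power2_eq_square)
    finally show ?thesis .
  qed
  have "expectation (\<lambda>\<omega>. (W n \<omega>)^2)
      = Q n * (expectation (\<lambda>\<omega>. (W 0 \<omega>)^2) + (\<Sum>j=1..n. h j / Q j))"
  proof (rule linear_recurrence_closed_form)
    fix j assume j: "j < n"
    \<comment> \<open>The factor 0 is kept so that \<open>second_moment_step\<close> matches with
      \<open>v = 0\<close> and \<open>u = 1 / (T j)^2\<close>: the binomial second factorial moment
      has no linear term in \<open>w\<close>.\<close>
    have "expectation (\<lambda>\<omega>. (W (Suc j) \<omega>)^2)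
        = (1 + 2 * c * real m / T j + c^2 * (real m * (real m - 1) * (1 / (T j)^2)))
            * expectation (\<lambda>\<omega>. (W j \<omega>)^2)
          + (c^2 * (real m / T j - real m * (real m - 1) * 0)
              + 2 * real m * am * c / T j + 2 * am) * expectation (W j) + am^2"
      unfolding c_def am_def T_def W_def
    proof (rule second_moment_step)
      fix w z assume wz: "w + z = int (W0 + B0) + \<sigma> * int j"
      have size: "w + z \<noteq> 0" using urn_total_ge[of j] sample_size wz by linarith
      have Twz: "urn_total \<sigma> W0 B0 j = real_of_int (w + z)" by (simp only: urn_total_eq wz)
      note moments = with_replacement_moments[OF sample_size size]
      show "(\<Sum>k\<le>m. p m w z k) = 1"
        unfolding p by (rule moments)
      show "(\<Sum>k\<le>m. real k * p m w z k) = real m * real_of_int w / urn_total \<sigma> W0 B0 j"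
        unfolding p Twz by (rule moments)
      show "(\<Sum>k\<le>m. real k * (real k - 1) * p m w z k) = real m * (real m - 1) *
          (1 / (urn_total \<sigma> W0 B0 j)^2 * (real_of_int w)^2 - 0 * real_of_int w)"
        unfolding p Twz moments(3) by simp
    qed
    then show "expectation (\<lambda>\<omega>. (W (Suc j) \<omega>)^2)
        = Q (Suc j) / Q j * expectation (\<lambda>\<omega>. (W j \<omega>)^2) + h (Suc j)"
      by (simp add: Q_step[OF j] h_def beta_with_def)
  qed (use bins in \<open>auto simp: Q_def\<close>)
  then show ?thesis
    by (simp add: Q_def h_def W_def prob_space power2_eq_square)
qed

text \<open>The side conditions exclude zero denominators in the formulas, where HOL division would
  return 0. The remaining denominators are nonzero because all totals are positive.\<close>

theorem proposition3:
  fixes P :: "'s measure" and X :: "nat \<Rightarrow> 's \<Rightarrow> nat"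
    and m W0 B0 n :: nat and a b :: "nat \<Rightarrow> int" and \<sigma> :: int
  assumes urn: "balanced_affine_urn m a b \<sigma> W0 B0"
  shows
    "let c = real_of_int (a (m - 1) - a m); am = real_of_int (a m); s = real_of_int \<sigma>;
         T = urn_total \<sigma> W0 B0; T0 = T 0;
         W = (\<lambda>j \<omega>. real_of_int (balls m a W0 X j \<omega>));
         l1 = lam1 m c T0 s; l2 = lam2 m c T0 s; u1 = mu1 m c T0 s; u2 = mu2 m c T0 s
     in
      (urn_process P without_replacement m a b W0 B0 X \<and>
       (\<forall>j\<in>{1..n}. T (j - 1) \<noteq> 1 \<and> bin l1 j \<noteq> 0 \<and> bin l2 j \<noteq> 0) \<longrightarrow>
         integral\<^sup>L P (\<lambda>\<omega>. (W n \<omega>)^2) =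
           bin l1 n * bin l2 n / (bin (T0 / s) n * bin ((T0 - 1) / s) n) *
           ((real W0)^2 + (\<Sum>j=1..n.
               (beta_without m c am (T (j - 1)) * integral\<^sup>L P (W (j - 1)) + am^2) *
               bin (T0 / s) j * bin ((T0 - 1) / s) j / (bin l1 j * bin l2 j))))
      \<and>
      (urn_process P with_replacement m a b W0 B0 X \<and>
       (\<forall>j\<in>{1..n}. bin u1 j \<noteq> 0 \<and> bin u2 j \<noteq> 0) \<longrightarrow>
         integral\<^sup>L P (\<lambda>\<omega>. (W n \<omega>)^2) =
           bin u1 n * bin u2 n / (bin (T0 / s) n)^2 *
           ((real W0)^2 + (\<Sum>j=1..n.
               (beta_with m c am (T (j - 1)) * integral\<^sup>L P (W (j - 1)) + am^2) *
               (bin (T0 / s) j)^2 / (bin u1 j * bin u2 j))))"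
proof -
  interpret balanced_affine_urn m a b \<sigma> W0 B0 by (rule urn)
  have process: "affine_urn_process P p m a b \<sigma> W0 B0 X" if "urn_process P p m a b W0 B0 X" for p
    using urn that by (rule affine_urn_process.intro)
  show ?thesis
    unfolding Let_def
    using affine_urn_process.second_moment_without_replacement[OF process refl, of n]
      affine_urn_process.second_moment_with_replacement[OF process refl, of n]
    by auto
qed

end
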